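(* Let $F \colon \mathbb{R}^n \times \mathbb{R}^m \to \mathbb{R}^n$ be $C^1$. Assume that the recursion $x_{k+1} = F_\theta(x_k)$ converges globally (i.e. from every starting point $x_0 \in \mathbb{R}^n$), locally uniformly in $\theta$, to the unique fixed point $\bar{x}(\theta)$ of $F_\theta$, and that $J_x F(\bar{x}(\theta),\theta) = 0$ for every $\theta \in \mathbb{R}^m$. Then, for every $\theta \in \mathbb{R}^m$, $J^{\mathrm{OS}} x_k(\theta) \to J_\theta \bar{x}(\theta)$ as $k \to \infty$, and $J^{\mathrm{OS}} \bar{x}(\theta) = J_\theta \bar{x}(\theta)$.
   Context: Write $F_\theta \colon x \mapsto F(x,\theta)$. $J_x F(x,\theta) \in \mathbb{R}^{n\times n}$ and $J_\theta F(x,\theta) \in \mathbb{R}^{n \times m}$ denote the partial Jacobian matrices of $F$ with respect to its first and second variable. The iterates are defined by $x_0(\theta) \in \mathbb{R}^n$ and $x_{k+1}(\theta) = F(x_k(\theta),\theta)$ for $k \geq 0$. Under the stated hypotheses, $\theta \mapsto \bar{x}(\theta)$ is $C^1$, with Jacobian denoted $J_\theta \bar{x}(\theta)$. The one-step estimator is defined, for $k \geq 1$, as $J^{\mathrm{OS}} x_k(\theta) := J_\theta F(x_{k-1}(\theta), \theta)$, i.e. the partial Jacobian of $F$ in its second variable evaluated at the point $(x_{k-1}(\theta),\theta)$ (the dependence of $x_{k-1}$ on $\theta$ is not differentiated). Likewise $J^{\mathrm{OS}} \bar{x}(\theta) := J_\theta F(\bar{x}(\theta),\theta)$ is the partial Jacobian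 evaluated at the point $(\bar{x}(\theta),\theta)$. *)

theory Defs
  imports "HOL-Analysis.Analysis"
begin

definition C1 :: "('a::real_normed_vector \<Rightarrow> 'b::real_normed_vector) \<Rightarrow> bool" where
  "C1 f \<longleftrightarrow>
     (\<exists>f'. (\<forall>z. (f has_derivative blinfun_apply (f' z)) (at z)) \<and> continuous_on UNIV f')"

definition locally_uniform_limit ::
  "(nat \<Rightarrow> 'a::topological_space \<Rightarrow> 'b::metric_space) \<Rightarrow> ('a \<Rightarrow> 'b) \<Rightarrow> bool" where
  "locally_uniform_limit f l \<longleftrightarrow>
     (\<forall>a. \<exists>U. open U \<and> a \<in> U \<and> uniform_limit U f l sequentially)"

definition jac_x ::
  "((real^'n) \<times> (real^'m) \<Rightarrow> real^'n) \<Rightarrow> real^'n \<Rightarrow> real^'m \<Rightarrow> real^'n^'n" where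
  "jac_x F x \<theta> = jacobian (\<lambda>y. F (y, \<theta>)) (at x)"

definition jac_theta ::
  "((real^'n) \<times> (real^'m) \<Rightarrow> real^'n) \<Rightarrow> real^'n \<Rightarrow> real^'m \<Rightarrow> real^'m^'n" where
  "jac_theta F x \<theta> = jacobian (\<lambda>t. F (x, t)) (at \<theta>)"

primrec iterate ::
  "('x \<times> 'p \<Rightarrow> 'x) \<Rightarrow> ('p \<Rightarrow> 'x) \<Rightarrow> nat \<Rightarrow> 'p \<Rightarrow> 'x" where
  "iterate F x0 0 \<theta> = x0 \<theta>"
| "iterate F x0 (Suc k) \<theta> = F (iterate F x0 k \<theta>, \<theta>)"

(* Meaningful for k >= 1 only; at k = 0 the truncated subtraction gives the value at k = 1. *)
definition one_step_iterate ::
  "((real^'n) \<times> (real^'m) \<Rightarrow> real^'n) \<Rightarrow> (real^'m \<Rightarrow> real^'n) \<Rightarrow> nat \<Rightarrow> real^'m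
     \<Rightarrow> real^'m^'n" where
  "one_step_iterate F x0 k \<theta> = jac_theta F (iterate F x0 (k - 1) \<theta>) \<theta>"

definition one_step_limit ::
  "((real^'n) \<times> (real^'m) \<Rightarrow> real^'n) \<Rightarrow> (real^'m \<Rightarrow> real^'n) \<Rightarrow> real^'m \<Rightarrow> real^'m^'n" where
  "one_step_limit F xbar \<theta> = jac_theta F (xbar \<theta>) \<theta>"

end

theory Submission
  imports Defs
begin

text \<open>
  The fixed point map is continuous as a locally uniform limit of continuous maps. Put
  \<open>d = xbar t - xbar \<theta>\<close> and \<open>h = t - \<theta>\<close>. As the derivative of \<open>F\<close> in the first variable vanishes
  at \<open>(xbar \<theta>, \<theta>)\<close>, expanding the fixed point equation there gives
  \<open>d = J h + o(norm d + norm h)\<close> with \<open>J\<close> the partial derivative in \<open>\<theta>\<close>. This absorbs the \<open>d\<close> on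
  the right, so \<open>J\<close> is the derivative of \<open>xbar\<close>, without the implicit function theorem; it depends
  continuously on \<open>\<theta>\<close>, and the one-step estimator converges to it by continuity of the derivative
  of \<open>F\<close>.
\<close>

text \<open>At a fixed parameter only the value \<open>x0 \<theta>\<close> matters. Convergence is
  known for constant starts, so this carries it to a start depending arbitrarily on
  \<theta>.\<close>

lemma iterate_const_start: "iterate F x0 k \<theta> = iterate F (\<lambda>_. x0 \<theta>) k \<theta>"
  by (induction k) auto

lemma continuous_on_iterate:
  assumes "continuous_on UNIV F" "continuous_on UNIV x0"
  shows "continuous_on UNIV (iterate F x0 k)"
proof (induction k)
  case 0
  then show ?case using assms(2) by simp
next
  case (Suc k)
  have "continuous_on UNIV (\<lambda>\<theta>. F (iterate F x0 k \<theta>, \<theta>))"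
    by (rule continuous_on_compose2[OF assms(1)]) (auto intro!: continuous_intros Suc)
  then show ?case by simp
qed

lemma locally_uniform_limit_continuous_on:
  fixes l :: "'a::t2_space \<Rightarrow> 'b::metric_space"
  assumes "locally_uniform_limit f l" "\<And>n. continuous_on UNIV (f n)"
  shows "continuous_on UNIV l"
proof -
  have "isCont l a" for a
  proof -
    obtain U where U: "open U" "a \<in> U" "uniform_limit U f l sequentially"
      using assms(1) unfolding locally_uniform_limit_def by blast
    have "continuous_on U l"
      by (rule uniform_limit_theorem[OF _ U(3)])
        (auto intro!: always_eventually continuous_on_subset[OF assms(2)])
    then show ?thesis using U by (simp add: continuous_on_eq_continuous_at)
  qed
  then show ?thesis by (simp add: continuous_at_imp_continuous_on)
qed

lemma locally_uniform_limit_tendsto: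
  assumes "locally_uniform_limit f l"
  shows "(\<lambda>n. f n a) \<longlonglongrightarrow> l a"
  proof -
  obtain U where "a \<in> U" "uniform_limit U f l sequentially"
    using assms unfolding locally_uniform_limit_def by blast
  then show ?thesis by (rule tendsto_uniform_limitI[rotated])
qed

text \<open>Continuity of \<open>g\<close> brings \<open>(g t, t)\<close> into the region where the
  expansion of \<open>F\<close> holds. A first use of the expansion gives a Lipschitz bound for
  \<open>g\<close> at \<theta>, and a second turns the remainder into
  \<open>o(norm (t - \<theta>))\<close>.\<close>

lemma has_derivative_fixed_point:
  fixes F :: "'a::real_normed_vector \<times> 'b::real_normed_vector \<Rightarrow> 'a"
  assumes F: "(F has_derivative D) (at (g \<theta>, \<theta>))"
    and fp: "\<And>t. F (g t, t) = g t"
    and cont: "isCont g \<theta>"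
    and D0: "\<And>u. D (u, 0) = 0"
  shows "(g has_derivative (\<lambda>v. D (0, v))) (at \<theta>)"
proof -
  have bl: "bounded_linear D" using F by (rule has_derivative_bounded_linear)
  have blB: "bounded_linear (\<lambda>v. D (0, v))"
    by (intro bounded_linear_compose[OF bl] bounded_linear_Pair
        bounded_linear_zero bounded_linear_ident)
  obtain K where K: "K > 0" "\<And>v. norm (D (0, v)) \<le> norm v * K"
    using bounded_linear.pos_bounded[OF blB] by blast
  have Dsnd: "D (u, v) = D (0, v)" for u v
    using linear_add[OF bounded_linear.linear[OF bl], of "(u, 0)" "(0, v)"] D0 by simp
  show ?thesis
    unfolding has_derivative_at_alt
  proof (intro conjI allI impI)
    show "bounded_linear (\<lambda>v. D (0, v))" by (rule blB)
  next
    fix e :: real assume e: "0 < e"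
    \<comment> \<open>The bound \<open>1/2\<close> lets the \<open>norm ?d\<close> term be absorbed
      on the left; the other bound turns the resulting factor \<open>2 * K + 2\<close> into
      \<open>e\<close>.\<close>
    define c where "c = min (1/2) (e / (2 * K + 2))"
    have c: "c > 0" "c \<le> 1/2"
      using e K(1) unfolding c_def by (simp, intro min.cobounded1)
    have "c \<le> e / (2 * K + 2)"
      by (simp add: c_def)
    then have ce: "c * (2 * K + 2) \<le> e"
      using K(1) by (simp add: pos_le_divide_eq)
    obtain \<delta> where \<delta>: "\<delta> > 0"
      "\<And>z. norm (z - (g \<theta>, \<theta>)) < \<delta> \<Longrightarrow>
         norm (F z - F (g \<theta>, \<theta>) - D (z - (g \<theta>, \<theta>))) \<le> c * norm (z - (g \<theta>, \<theta>))"
      using F c(1) unfolding has_derivative_at_alt by blast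
    have "isCont (\<lambda>t. (g t, t)) \<theta>" by (intro continuous_intros cont)
    then obtain r where r: "r > 0" "\<And>t. norm (t - \<theta>) < r \<Longrightarrow> norm ((g t, t) - (g \<theta>, \<theta>)) < \<delta>"
      using \<delta>(1) unfolding continuous_at_eps_delta dist_norm by blast
    have "norm (g t - g \<theta> - D (0, t - \<theta>)) \<le> e * norm (t - \<theta>)" if t: "norm (t - \<theta>) < r" for t
    proof -
      let ?d = "g t - g \<theta>" and ?h = "t - \<theta>"
      have "norm (?d - D (0, ?h)) \<le> c * norm (?d, ?h)"
        using \<delta>(2)[OF r(2)[OF t]] by (simp add: fp Dsnd[of ?d])
      also have "\<dots> \<le> c * (norm ?d + norm ?h)"
        using c by (intro mult_left_mono norm_Pair_le) auto
      finally have 1: "norm (?d - D (0, ?h)) \<le> c * (norm ?d + norm ?h)" .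
      also have "\<dots> \<le> 1/2 * (norm ?d + norm ?h)"
        using c by (intro mult_right_mono) auto
      \<comment> \<open>Here \<open>norm ?d\<close> is at most \<open>K * norm ?h\<close> plus half
        of \<open>norm ?d + norm ?h\<close>; solve for \<open>norm ?d\<close>.\<close>
      finally have "norm ?d \<le> (2 * K + 1) * norm ?h"
        using norm_triangle_sub[of ?d "D (0, ?h)"] K(2)[of ?h] by (simp add: algebra_simps)
      \<comment> \<open>The Lipschitz bound goes back into estimate \<open>1\<close>, which still
        has the small factor \<open>c\<close>.\<close>
      then have "c * (norm ?d + norm ?h) \<le> c * ((2 * K + 2) * norm ?h)"
        using c by (intro mult_left_mono) (auto simp: algebra_simps)
      also have "\<dots> \<le> e * norm ?h"
        using mult_right_mono[OF ce, of "norm ?h"] by (simp add: mult.assoc)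
      finally show ?thesis using 1 by linarith
    qed
    then show "\<exists>d>0. \<forall>y. norm (y - \<theta>) < d \<longrightarrow> norm (g y - g \<theta> - D (0, y - \<theta>)) \<le> e * norm (y - \<theta>)"
      using r(1) by blast
  qed
qed

lemma jacobian_eq_matrix: "(f has_derivative D) (at x) \<Longrightarrow> jacobian f (at x) = matrix D"
  by (simp add: jacobian_def frechet_derivative_at[symmetric])

text \<open>Matrix entries are components of values at basis vectors, so pointwise convergence
  suffices.\<close>

lemma tendsto_matrix:
  fixes f :: "'c \<Rightarrow> real^'m \<Rightarrow> real^'n"
  assumes "\<And>v. ((\<lambda>k. f k v) \<longlongrightarrow> g v) X"
  shows "((\<lambda>k. matrix (f k)) \<longlongrightarrow> matrix g) X"
  unfolding matrix_def
  by (intro tendsto_vec_lambda tendsto_vec_nth assms)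

theorem corollary2:
  fixes F :: "(real^'n) \<times> (real^'m) \<Rightarrow> real^'n"
    and xbar :: "real^'m \<Rightarrow> real^'n"
    and x0 :: "real^'m \<Rightarrow> real^'n"
  assumes "C1 F"
    and fixed_point: "\<And>\<theta>. F (xbar \<theta>, \<theta>) = xbar \<theta>"
    and unique: "\<And>\<theta> y. F (y, \<theta>) = y \<Longrightarrow> y = xbar \<theta>"
    and convergence: "\<And>y. locally_uniform_limit (iterate F (\<lambda>_. y)) xbar"
    and superlinear: "\<And>\<theta>. jac_x F (xbar \<theta>) \<theta> = 0"
  shows "C1 xbar \<and>
    (\<forall>\<theta>. (\<lambda>k. one_step_iterate F x0 k \<theta>) \<longlonglongrightarrow> jacobian xbar (at \<theta>) \<and>
         one_step_limit F xbar \<theta> = jacobian xbar (at \<theta>))"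
proof -
  obtain F' where F': "\<And>z. (F has_derivative blinfun_apply (F' z)) (at z)"
    and contF': "continuous_on UNIV F'"
    using \<open>C1 F\<close> unfolding C1_def by blast
  have contF: "continuous_on UNIV F"
    using F' has_derivative_continuous continuous_at_imp_continuous_on by blast
  have contx: "continuous_on UNIV xbar"
    by (rule locally_uniform_limit_continuous_on[OF convergence continuous_on_iterate[OF contF]])
      simp
  have dx: "((\<lambda>y. F (y, \<theta>)) has_derivative (\<lambda>u. F' (x, \<theta>) (u, 0))) (at x)" for x \<theta>
    by (rule has_derivative_compose[OF _ F', of "\<lambda>y. (y, \<theta>)" "\<lambda>u. (u, 0)" x UNIV])
      (auto intro!: derivative_eq_intros)
  have dt: "((\<lambda>t. F (x, t)) has_derivative (\<lambda>v. F' (x, \<theta>) (0, v))) (at \<theta>)" for x \<theta>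
    by (rule has_derivative_compose[OF _ F', of "\<lambda>t. (x, t)" "\<lambda>v. (0, v)" \<theta> UNIV])
      (auto intro!: derivative_eq_intros)
  have jac_theta: "jac_theta F x \<theta> = matrix (\<lambda>v. F' (x, \<theta>) (0, v))" for x \<theta>
    unfolding jac_theta_def by (rule jacobian_eq_matrix[OF dt])
  \<comment> \<open>The hypothesis speaks of a matrix; by linearity the map is multiplication by
    that matrix, hence zero.\<close>
  have D0: "F' (xbar \<theta>, \<theta>) (u, 0) = 0" for \<theta> u
  proof -
    have "matrix (\<lambda>u. F' (xbar \<theta>, \<theta>) (u, 0)) = 0"
      using superlinear[of \<theta>] jacobian_eq_matrix[OF dx] unfolding jac_x_def by simp
    then show ?thesis
      using fun_cong[OF matrix_vector_mul(2)[OF has_derivative_linear[OF dx]], of "xbar \<theta>" \<theta> u]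
      by simp
  qed
  have dxbar: "(xbar has_derivative (\<lambda>v. F' (xbar \<theta>, \<theta>) (0, v))) (at \<theta>)" for \<theta>
    using contx
    by (intro has_derivative_fixed_point[OF F' fixed_point _ D0])
      (simp add: continuous_on_eq_continuous_at)
  \<comment> \<open>\<open>C1\<close> asks for continuity in operator norm, so the derivative is
    written as a composition of bounded operators.\<close>
  define xbar' where "xbar' = (\<lambda>\<theta>. F' (xbar \<theta>, \<theta>) o\<^sub>L Blinfun (Pair 0))"
  have "bounded_linear (Pair (0::real^'n) :: real^'m \<Rightarrow> _)"
    by (intro bounded_linear_Pair bounded_linear_zero bounded_linear_ident)
  then have "blinfun_apply (xbar' \<theta>) = (\<lambda>v. F' (xbar \<theta>, \<theta>) (0, v))" for \<theta>
    by (simp add: xbar'_def bounded_linear_Blinfun_apply fun_eq_iff)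
  then have "(xbar has_derivative blinfun_apply (xbar' \<theta>)) (at \<theta>)" for \<theta>
    using dxbar by simp
  moreover have "continuous_on UNIV xbar'"
    unfolding xbar'_def
    by (intro continuous_intros continuous_on_compose2[OF contF'] contx) auto
  ultimately have "C1 xbar" unfolding C1_def by blast
  moreover have jac: "jacobian xbar (at \<theta>) = one_step_limit F xbar \<theta>" for \<theta>
    unfolding one_step_limit_def jac_theta by (rule jacobian_eq_matrix[OF dxbar])
  moreover have "(\<lambda>k. one_step_iterate F x0 k \<theta>) \<longlonglongrightarrow> one_step_limit F xbar \<theta>" for \<theta>
  proof -
    have "(\<lambda>k. iterate F x0 k \<theta>) \<longlonglongrightarrow> xbar \<theta>"
      unfolding iterate_const_start[of F x0]
      by (rule locally_uniform_limit_tendsto[OF convergence])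
    \<comment> \<open>The truncated value at \<open>k = 0\<close> is a single term and does not
      affect the limit.\<close>
    moreover have "filterlim (\<lambda>k. k - 1) sequentially sequentially"
      by (rule filterlim_minus_const_nat_at_top)
    ultimately have "(\<lambda>k. iterate F x0 (k - 1) \<theta>) \<longlonglongrightarrow> xbar \<theta>"
      by (rule filterlim_compose)
    then have "(\<lambda>k. F' (iterate F x0 (k - 1) \<theta>, \<theta>)) \<longlonglongrightarrow> F' (xbar \<theta>, \<theta>)"
      by (intro continuous_on_tendsto_compose[OF contF'] tendsto_Pair tendsto_const) auto
    then show ?thesis
      unfolding one_step_iterate_def one_step_limit_def jac_theta
      by (intro tendsto_matrix tendsto_intros)
  qed
  ultimately show ?thesis by simp
qed

end
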